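(* Let $q$ be a prime power and let $1\le n\le\ell$ be integers. Let $\mathcal L$ be a Cameron-Liebler set in ${\rm Bil}_q(n,\ell)$ with parameter $x=1$. Then $\mathcal L$ is trivial.
   Context: Let $E=\langle e_{n+1},\dots,e_{n+\ell}\rangle\subseteq\mathbb F_q^{n+\ell}$, where $e_i$ are the standard basis vectors. For $1\le m\le n$, $\mathcal M_m$ is the set of $m$-dimensional subspaces $P$ of $\mathbb F_q^{n+\ell}$ with $P\cap E=\{0\}$. The bilinear forms graph ${\rm Bil}_q(n,\ell)$ has vertex set $\mathcal M_n$, two vertices being adjacent if their intersection has dimension $n-1$. Let $M$ be the real $0/1$ incidence matrix with rows indexed by $\mathcal M_1$ and columns indexed by $\mathcal M_n$ (entry $1$ iff contained). For $\mathcal S\subseteq\mathcal M_n$, $\chi_{\mathcal S}\in\mathbb R^{\mathcal M_n}$ is its characteristic vector. A subset $\mathcal L\subseteq\mathcal M_n$ is a Cameron-Liebler set in ${\rm Bil}_q(n,\ell)$ with parameter $x=q^{-(n-1)\ell}|\mathcal L|$ if $\chi_{\mathcal L}\in{\rm Im}(M^t)$ (over $\mathbb R$). A family $\mathcal F\subseteq\mathcal M_n$ is intersecting if $\dim(\pi\cap\pi')\ge1$ for all $\pi,\pi'\in\mathcal F$. A Cameron-Liebler set with parameter $x$ is trivial if it is a union of $x$ intersecting families. *)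

theory Defs
  imports "HOL-Analysis.Cartesian_Space" "HOL-Library.FuncSet"
begin

text \<open>
  The field of order \<open>q\<close> is a type \<open>'a :: {field, finite}\<close> with \<open>CARD('a) = q\<close>.  The coordinates of
  the ambient space of dimension \<open>n + \<ell>\<close> are indexed by a sum type \<open>'n + 'l\<close> with \<open>CARD('n) = n\<close>
  and \<open>CARD('l) = \<ell>\<close>: the indices \<open>Inl i\<close> stand for \<open>1, \<dots>, n\<close> and \<open>Inr j\<close> for
  \<open>n + 1, \<dots>, n + \<ell>\<close>.  Since types are nonempty, \<open>n \<ge> 1\<close> and \<open>\<ell> \<ge> 1\<close> hold automatically.
\<close>

definition bil_E :: "('a::{field, finite} ^ ('n::finite + 'l::finite)) set" where
  "bil_E = vec.span (range (\<lambda>j. axis (Inr j) 1))"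

definition bil_M :: "nat \<Rightarrow> ('a::{field, finite} ^ ('n::finite + 'l::finite)) set set" where
  "bil_M m = {P. vec.subspace P \<and> vec.dim P = m \<and> P \<inter> bil_E = {0}}"

abbreviation bil_points :: "('a::{field, finite} ^ ('n::finite + 'l::finite)) set set" where
  "bil_points \<equiv> bil_M 1"

abbreviation bil_vertices :: "('a::{field, finite} ^ ('n::finite + 'l::finite)) set set" where
  "bil_vertices \<equiv> bil_M CARD('n)"

definition incidence ::
  "('a::{field, finite} ^ ('n::finite + 'l::finite)) set \<Rightarrow> ('a ^ ('n + 'l)) set \<Rightarrow> real" where
  "incidence P \<pi> = (if P \<subseteq> \<pi> then 1 else 0)"

text \<open>
  A real vector with coordinates indexed by a set \<open>I\<close> is an extensional function in
  \<open>I \<rightarrow>\<^sub>E UNIV\<close>.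
\<close>

definition char_vec ::
  "('a::{field, finite} ^ ('n::finite + 'l::finite)) set set \<Rightarrow> ('a ^ ('n + 'l)) set \<Rightarrow> real" where
  "char_vec S = (\<lambda>\<pi>\<in>bil_vertices. if \<pi> \<in> S then 1 else 0)"

definition im_incidence_transpose ::
  "(('a::{field, finite} ^ ('n::finite + 'l::finite)) set \<Rightarrow> real) set" where
  "im_incidence_transpose =
    (\<lambda>y. \<lambda>\<pi>\<in>bil_vertices. \<Sum>P\<in>bil_points. incidence P \<pi> * y P) ` (bil_points \<rightarrow>\<^sub>E UNIV)"

definition cameron_liebler ::
  "('a::{field, finite} ^ ('n::finite + 'l::finite)) set set \<Rightarrow> real \<Rightarrow> bool" where
  "cameron_liebler L x \<longleftrightarrow>
    L \<subseteq> bil_vertices \<and> char_vec L \<in> im_incidence_transpose \<and>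
    x = real (card L) / real CARD('a) ^ ((CARD('n) - 1) * CARD('l))"

definition intersecting_family ::
  "('a::{field, finite} ^ ('n::finite + 'l::finite)) set set \<Rightarrow> bool" where
  "intersecting_family F \<longleftrightarrow>
    F \<subseteq> bil_vertices \<and> (\<forall>\<pi>\<in>F. \<forall>\<pi>'\<in>F. vec.dim (\<pi> \<inter> \<pi>') \<ge> 1)"

text \<open>
  The parameter \<open>x\<close> is a priori only a rational number; being a union of \<open>x\<close> families includes the
  requirement that \<open>x\<close> is a natural number.
\<close>

definition trivial_CL ::
  "('a::{field, finite} ^ ('n::finite + 'l::finite)) set set \<Rightarrow> real \<Rightarrow> bool" where
  "trivial_CL L x \<longleftrightarrow>
    cameron_liebler L x \<and>
    (\<exists>k F. x = real k \<and> (\<forall>i<k. intersecting_family (F i)) \<and> L = (\<Union>i<k. F i))"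

end

theory Submission
  imports Defs
begin

text \<open>
  The vertices are the graphs of the linear maps \<open>A\<close> from the first \<open>n\<close> coordinates to the last
  \<open>\<ell>\<close> ones, and a point spanned by \<open>(u, w)\<close> with \<open>u \<noteq> 0\<close> lies on the graph of \<open>A\<close> iff \<open>A u = w\<close>.
  Write the characteristic function of \<open>\<L>\<close> as \<open>f(A) = (\<Sum>P on A. y P)\<close> and let \<open>Y = (\<Sum>P. y P)\<close>.
  Every point lies on \<open>q ^ ((n - 1) \<ell>)\<close> vertices, so summing \<open>f\<close> over all vertices gives \<open>Y = x = 1\<close>.
  Now fix a vertex \<open>A\<close> and sum \<open>f\<close> over the vertices \<open>B\<close> disjoint from \<open>A\<close>.  A point on \<open>A\<close> lies on no
  such \<open>B\<close>, and every other point lies on the same number \<open>K\<close> of them, because \<open>GL(n) \<times> GL(\<ell>)\<close>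
  acts transitively on pairs of nonzero vectors.  Hence the sum equals \<open>K (Y - f(A))\<close>, which vanishes
  for \<open>A \<in> \<L>\<close>: no two elements of \<open>\<L>\<close> are disjoint.
\<close>

section \<open>Vertices as graphs of matrices\<close>

definition fst_part :: "'a ^ ('n::finite + 'l::finite) \<Rightarrow> 'a ^ 'n" where
  "fst_part x = (\<chi> i. x $ Inl i)"

definition snd_part :: "'a ^ ('n::finite + 'l::finite) \<Rightarrow> 'a ^ 'l" where
  "snd_part x = (\<chi> j. x $ Inr j)"

definition join_parts :: "'a ^ 'n::finite \<Rightarrow> 'a ^ 'l::finite \<Rightarrow> 'a ^ ('n + 'l)" where
  "join_parts u w = (\<chi> k. case k of Inl i \<Rightarrow> u $ i | Inr j \<Rightarrow> w $ j)"

definition matrix_graph :: "'a::field ^ 'n ^ 'l \<Rightarrow> ('a ^ ('n::finite + 'l::finite)) set" where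
  "matrix_graph A = {x. A *v fst_part x = snd_part x}"

lemma fst_part_join [simp]: "fst_part (join_parts u w) = u"
  and snd_part_join [simp]: "snd_part (join_parts u w) = w"
  by (simp_all add: fst_part_def snd_part_def join_parts_def)

lemma join_parts_collapse [simp]: "join_parts (fst_part x) (snd_part x) = x"
  by (simp add: fst_part_def snd_part_def join_parts_def vec_eq_iff split: sum.split)

lemma parts_eqI: "fst_part x = fst_part y \<Longrightarrow> snd_part x = snd_part y \<Longrightarrow> x = y"
  by (metis join_parts_collapse)

lemma linear_parts:
  "Vector_Spaces.linear (*s) (*s) (fst_part :: 'a::field ^ ('n::finite + 'l::finite) \<Rightarrow> _)"
  "Vector_Spaces.linear (*s) (*s) (snd_part :: 'a::field ^ ('n::finite + 'l::finite) \<Rightarrow> _)"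
  by (unfold_locales; simp add: fst_part_def snd_part_def vec_eq_iff)+

lemma parts_zero [simp]:
  "fst_part (0 :: 'a::field ^ ('n::finite + 'l::finite)) = 0"
  "snd_part (0 :: 'a::field ^ ('n::finite + 'l::finite)) = 0"
  by (simp_all add: fst_part_def snd_part_def vec_eq_iff)

lemma linear_join_graph:
  "Vector_Spaces.linear (*s) (*s) (\<lambda>u. join_parts u (A *v u))" for A :: "'a::field ^ 'n ^ 'l"
  by unfold_locales
    (simp_all add: join_parts_def vec_eq_iff matrix_vector_right_distrib vec.scale split: sum.split)

text \<open>Seen as the kernel of \<open>fst_part\<close>, \<open>bil_E\<close> meets a subspace
  trivially exactly when \<open>fst_part\<close> is injective on that subspace.\<close>

lemma bil_E_eq:
  "bil_E = {x :: 'a::{field, finite} ^ ('n::finite + 'l::finite). fst_part x = 0}"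
proof
  have sub: "vec.subspace {x :: 'a ^ ('n + 'l). fst_part x = 0}"
    by (simp add: vec.subspace_def fst_part_def vec_eq_iff)
  show "bil_E \<subseteq> {x :: 'a ^ ('n + 'l). fst_part x = 0}"
    unfolding bil_E_def
    by (rule vec.span_minimal[OF _ sub]) (auto simp: fst_part_def vec_eq_iff axis_def)
next
  show "{x :: 'a ^ ('n + 'l). fst_part x = 0} \<subseteq> bil_E"
  proof
    fix x :: "'a ^ ('n + 'l)"
    assume "x \<in> {x. fst_part x = 0}"
    then have 0: "x $ Inl i = 0" for i
      by (simp add: fst_part_def vec_eq_iff)
    have "x = (\<Sum>j\<in>UNIV. x $ Inr j *s axis (Inr j) 1)"
      unfolding vec_eq_iff
    proof
      fix k
      show "x $ k = (\<Sum>j\<in>UNIV. x $ Inr j *s axis (Inr j) 1) $ k"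
        by (cases k) (auto simp: 0 axis_def if_distrib [of "\<lambda>z. _ * z"] cong: if_cong)
    qed
    also have "\<dots> \<in> bil_E"
      unfolding bil_E_def by (intro vec.span_sum vec.span_scale vec.span_base) auto
    finally show "x \<in> bil_E" .
  qed
qed

text \<open>The parametrised form shows the graph as an injective linear image of the first factor,
  which yields both the subspace property and the dimension.\<close>

lemma matrix_graph_eq_range: "matrix_graph A = range (\<lambda>u. join_parts u (A *v u))"
proof -
  have "x \<in> range (\<lambda>u. join_parts u (A *v u))" if "x \<in> matrix_graph A" for x
    using that by (intro image_eqI[of _ _ "fst_part x"]) (auto simp: matrix_graph_def)
  then show ?thesis
    by (auto simp: matrix_graph_def)
qed

lemma subspace_matrix_graph: "vec.subspace (matrix_graph A)"
  unfolding matrix_graph_eq_range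
  by (rule vec.linear_subspace_image[OF linear_join_graph vec.subspace_UNIV])

lemma matrix_graph_in_vertices:
  "matrix_graph (A :: 'a::{field, finite} ^ 'n::finite ^ 'l::finite) \<in> bil_vertices"
proof -
  have "inj (\<lambda>u. join_parts u (A *v u))"
    by (rule injI) (metis fst_part_join)
  then have "vec.dim (matrix_graph A) = vec.dim (UNIV :: ('a ^ 'n) set)"
    unfolding matrix_graph_eq_range
    by (intro vec.dim_image_eq[OF linear_join_graph]) auto
  moreover have "matrix_graph A \<inter> bil_E = {0}"
    by (auto simp: bil_E_eq matrix_graph_def intro: parts_eqI)
  ultimately show ?thesis
    by (simp add: bil_M_def subspace_matrix_graph card_cart_basis)
qed

lemma inj_matrix_graph: "inj matrix_graph"
proof (rule injI)
  fix A B :: "'a::field ^ 'n::finite ^ 'l::finite"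
  assume eq: "matrix_graph A = matrix_graph B"
  have "join_parts u (A *v u) \<in> matrix_graph B" for u
    unfolding eq[symmetric] by (simp add: matrix_graph_def)
  then show "A = B"
    by (simp add: matrix_graph_def matrix_eq)
qed

text \<open>On a vertex, \<open>fst_part\<close> is injective because the vertex avoids its kernel,
  and onto because the dimensions agree. The matrix is that of \<open>snd_part\<close> composed with
  the inverse \<open>g\<close>.\<close>

lemma vertex_is_matrix_graph:
  fixes p :: "('a::{field, finite} ^ ('n::finite + 'l::finite)) set"
  assumes "p \<in> bil_vertices"
  shows "\<exists>A. p = matrix_graph A"
proof -
  have sub: "vec.subspace p" and dim: "vec.dim p = CARD('n)" and E: "p \<inter> bil_E = {0}"
    using assms by (auto simp: bil_M_def)
  have inj: "inj_on fst_part p"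
  proof (rule inj_onI)
    fix x y assume xy: "x \<in> p" "y \<in> p" "fst_part x = fst_part y"
    then have "x - y \<in> p \<inter> bil_E"
      using vec.subspace_diff[OF sub] by (auto simp: bil_E_eq fst_part_def vec_eq_iff)
    with E show "x = y" by auto
  qed
  have "vec.dim (fst_part ` p) = CARD('n)"
    using vec.dim_image_eq[OF linear_parts(1), of p] inj dim
    by (simp add: vec.span_eq_iff[THEN iffD2, OF sub])
  then have surj: "fst_part ` p = UNIV"
    by (intro vec.subspace_dim_equal vec.linear_subspace_image[OF linear_parts(1) sub])
      (auto simp: card_cart_basis)
  obtain g where g: "range g \<subseteq> p" "Vector_Spaces.linear (*s) (*s) g" "\<forall>x\<in>p. g (fst_part x) = x"
    using vec.linear_exists_left_inverse_on[OF linear_parts(1) sub inj] by auto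
  define A where "A = matrix (snd_part \<circ> g)"
  have A: "A *v u = snd_part (g u)" for u
    unfolding A_def using matrix_works[OF Vector_Spaces.linear_compose[OF g(2) linear_parts(2)]] by simp
  have "x \<in> p" if "x \<in> matrix_graph A" for x
  proof -
    obtain y where y: "y \<in> p" "fst_part x = fst_part y"
      using surj by (metis UNIV_I imageE)
    with that g(3) have "snd_part x = snd_part y"
      by (simp add: matrix_graph_def A)
    with y show ?thesis using parts_eqI by metis
  qed
  moreover have "x \<in> matrix_graph A" if "x \<in> p" for x
    using that g(3) by (simp add: matrix_graph_def A)
  ultimately show ?thesis by blast
qed

text \<open>Take the two parts of a generator of \<open>P\<close>; the first is nonzero because
  \<open>P\<close> avoids \<open>bil_E\<close>. Incidence thus becomes a single linear equation on
  \<open>A\<close>, the form used in both counts.\<close>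

lemma point_generator:
  assumes "P \<in> bil_points"
  shows "\<exists>u w. u \<noteq> 0 \<and> (\<forall>A. P \<subseteq> matrix_graph A \<longleftrightarrow> A *v u = w)"
proof -
  have sub: "vec.subspace P" and dim: "vec.dim P = 1" and E: "P \<inter> bil_E = {0}"
    using assms by (auto simp: bil_M_def)
  obtain B where B: "B \<subseteq> P" "vec.independent B" "P \<subseteq> vec.span B" "card B = vec.dim P"
    using vec.basis_exists .
  then obtain p where p: "B = {p}"
    using dim by (metis card_1_singletonE)
  then have "p \<noteq> 0" "p \<in> P" and span: "P \<subseteq> vec.span {p}"
    using B vec.dependent_zero by auto
  then have "fst_part p \<noteq> 0"
    using E by (auto simp: bil_E_eq)
  moreover have "P \<subseteq> matrix_graph A \<longleftrightarrow> A *v fst_part p = snd_part p" for A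
  proof
    assume "A *v fst_part p = snd_part p"
    then have "vec.span {p} \<subseteq> matrix_graph A"
      by (intro vec.span_minimal subspace_matrix_graph) (simp add: matrix_graph_def)
    with span show "P \<subseteq> matrix_graph A" by blast
  qed (use \<open>p \<in> P\<close> in \<open>auto simp: matrix_graph_def\<close>)
  ultimately show ?thesis by blast
qed

text \<open>A common vector of the two graphs is determined by its first part, which ranges over the
  kernel of \<open>B - A\<close>.\<close>

lemma disjoint_matrix_graphs:
  fixes A B :: "'a::{field, finite} ^ 'n::finite ^ 'l::finite"
  shows "vec.dim (matrix_graph A \<inter> matrix_graph B) = 0 \<longleftrightarrow> inj ((*v) (B - A))"
proof -
  have "matrix_graph A \<inter> matrix_graph B \<subseteq> {0} \<longleftrightarrow> (\<forall>u. (B - A) *v u = 0 \<longrightarrow> u = 0)"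
  proof
    assume 0: "matrix_graph A \<inter> matrix_graph B \<subseteq> {0}"
    show "\<forall>u. (B - A) *v u = 0 \<longrightarrow> u = 0"
    proof (intro allI impI)
      fix u assume "(B - A) *v u = 0"
      then have "join_parts u (A *v u) \<in> matrix_graph A \<inter> matrix_graph B"
        by (simp add: matrix_graph_def matrix_vector_mult_diff_rdistrib)
      with 0 have "join_parts u (A *v u) = 0" by blast
      then show "u = 0" by (metis fst_part_join parts_zero(1))
    qed
  next
    assume "\<forall>u. (B - A) *v u = 0 \<longrightarrow> u = 0"
    then have fst0: "fst_part x = 0" if "x \<in> matrix_graph A \<inter> matrix_graph B" for x
      using that by (simp add: matrix_graph_def matrix_vector_mult_diff_rdistrib)
    have "snd_part x = 0" if "x \<in> matrix_graph A \<inter> matrix_graph B" for x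
      using that fst0[OF that] by (simp add: matrix_graph_def)
    with fst0 show "matrix_graph A \<inter> matrix_graph B \<subseteq> {0}"
      by (auto intro!: parts_eqI)
  qed
  then show ?thesis
    by (simp add: vec.inj_iff_eq_0)
qed

section \<open>Transitivity on nonzero vectors and the constant \<open>K\<close>\<close>

lemma exists_functional_nonzero_at_two:
  fixes x y :: "'a::field ^ 'n"
  assumes "x \<noteq> 0" "y \<noteq> 0"
  shows "\<exists>c :: 'a ^ 'n. (\<Sum>k\<in>UNIV. c $ k * x $ k) \<noteq> 0 \<and> (\<Sum>k\<in>UNIV. c $ k * y $ k) \<noteq> 0"
proof -
  obtain i j where ij: "x $ i \<noteq> 0" "y $ j \<noteq> 0"
    using assms by (auto simp: vec_eq_iff)
  have ax: "(\<Sum>k\<in>UNIV. axis m 1 $ k * z $ k) = z $ m" for m and z :: "'a ^ 'n"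
    by (simp add: axis_def if_distrib [of "\<lambda>t. t * _"] cong: if_cong)
  have ax2: "(\<Sum>k\<in>UNIV. (axis i 1 + axis j 1) $ k * z $ k) = z $ i + z $ j" for z :: "'a ^ 'n"
    by (simp add: distrib_right sum.distrib ax)
  \<comment> \<open>If neither coordinate is nonzero at both vectors, the cross values vanish, so
    the sum of the two coordinates takes the values \<open>x $ i\<close> and
    \<open>y $ j\<close>.\<close>
  consider "y $ i \<noteq> 0" | "x $ j \<noteq> 0" | "y $ i = 0" "x $ j = 0" by blast
  then show ?thesis
  proof cases
    case 1 then show ?thesis using ij by (intro exI[of _ "axis i 1"]) (simp add: ax)
  next
    case 2 then show ?thesis using ij by (intro exI[of _ "axis j 1"]) (simp add: ax)
  next
    case 3 then show ?thesis using ij by (intro exI[of _ "axis i 1 + axis j 1"]) (simp only: ax2, simp)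
  qed
qed

text \<open>A rank-one change of the identity along a functional \<open>\<phi>\<close> nonzero at
  both vectors works: it multiplies \<open>\<phi>\<close> by \<open>\<phi> y / \<phi> x\<close> and
  fixes the kernel of \<open>\<phi>\<close> pointwise. Dependent \<open>x\<close> and
  \<open>y\<close> need no separate case.\<close>

lemma injective_matrix_transitive:
  fixes x y :: "'a::field ^ 'n"
  assumes "x \<noteq> 0" "y \<noteq> 0"
  shows "\<exists>G :: 'a ^ 'n ^ 'n. inj ((*v) G) \<and> G *v x = y"
proof -
  obtain c :: "'a ^ 'n" where c: "(\<Sum>k\<in>UNIV. c $ k * x $ k) \<noteq> 0" "(\<Sum>k\<in>UNIV. c $ k * y $ k) \<noteq> 0"
    using exists_functional_nonzero_at_two[OF assms] by auto
  define \<phi> where "\<phi> z = (\<Sum>k\<in>UNIV. c $ k * z $ k)" for z :: "'a ^ 'n"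
  have add: "\<phi> (a + b) = \<phi> a + \<phi> b" and diff: "\<phi> (a - b) = \<phi> a - \<phi> b"
    and scale: "\<phi> (r *s a) = r * \<phi> a" for a b r
    by (simp_all add: \<phi>_def algebra_simps sum.distrib sum_subtractf sum_distrib_left)
  have nz: "\<phi> x \<noteq> 0" "\<phi> y \<noteq> 0"
    using c by (simp_all add: \<phi>_def)
  define g where "g z = z + (\<phi> z / \<phi> x) *s (y - x)" for z
  have lin: "Vector_Spaces.linear (*s) (*s) g"
    by unfold_locales (simp_all add: g_def add scale vec_eq_iff add_divide_distrib algebra_simps)
  have "z = 0" if "g z = 0" for z
  proof -
    have "\<phi> (g z) = \<phi> z * \<phi> y / \<phi> x"
      using nz by (simp add: g_def add scale diff field_simps)
    moreover have "\<phi> (g z) = 0"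
      using that by (simp add: \<phi>_def)
    ultimately have "\<phi> z = 0" using nz by simp
    with that show "z = 0" by (simp add: g_def)
  qed
  then have "inj ((*v) (matrix g))"
    unfolding vec.inj_iff_eq_0 by (simp add: matrix_works[OF lin])
  moreover have "matrix g *v x = y"
    using nz by (simp add: matrix_works[OF lin]) (simp add: g_def)
  ultimately show ?thesis by blast
qed

text \<open>The substitution of \<open>H ** C ** G\<close> for \<open>C\<close> embeds the first set
  into the second. The hypotheses are symmetric in the two pairs, so equality follows by applying
  the bound twice.\<close>

lemma card_injective_matrices_mono:
  fixes u u' :: "'a::{field, finite} ^ 'n::finite" and w w' :: "'a ^ 'l::finite"
  assumes "u \<noteq> 0" "u' \<noteq> 0" "w \<noteq> 0" "w' \<noteq> 0"
  shows "card {C :: 'a ^ 'n ^ 'l. inj ((*v) C) \<and> C *v u = w}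
    \<le> card {C :: 'a ^ 'n ^ 'l. inj ((*v) C) \<and> C *v u' = w'}"
proof -
  obtain G :: "'a ^ 'n ^ 'n" where G: "inj ((*v) G)" "G *v u' = u"
    using injective_matrix_transitive assms by metis
  obtain H :: "'a ^ 'l ^ 'l" where H: "inj ((*v) H)" "H *v w = w'"
    using injective_matrix_transitive assms by metis
  \<comment> \<open>Finiteness makes \<open>G\<close> onto, so \<open>C\<close> can be recovered
    from its values on the image of \<open>G\<close>.\<close>
  have "surj ((*v) G)"
    using G(1) by (intro finite_UNIV_inj_surj) auto
  have app: "(H ** C ** G) *v z = H *v (C *v (G *v z))" for C :: "'a ^ 'n ^ 'l" and z
    by (simp add: matrix_vector_mul_assoc matrix_mul_assoc)
  show ?thesis
  proof (rule card_inj_on_le[of "\<lambda>C. H ** C ** G"])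
    show "inj_on (\<lambda>C. H ** C ** G) {C. inj ((*v) C) \<and> C *v u = w}"
    proof (rule inj_onI)
      fix C D assume "H ** C ** G = H ** D ** G"
      then have "C *v (G *v z) = D *v (G *v z)" for z
        using H(1) app by (metis injD)
      with \<open>surj ((*v) G)\<close> show "C = D"
        by (metis matrix_eq surjD)
    qed
    show "(\<lambda>C. H ** C ** G) ` {C. inj ((*v) C) \<and> C *v u = w}
        \<subseteq> {C. inj ((*v) C) \<and> C *v u' = w'}"
    proof (safe intro!: injI)
      fix C :: "'a ^ 'n ^ 'l" and a b
      assume "inj ((*v) C)" "(H ** C ** G) *v a = (H ** C ** G) *v b"
      then show "a = b" using G(1) H(1) by (simp add: app inj_eq)
    qed (use G H in \<open>simp add: app\<close>)
  qed simp
qed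

text \<open>Translation by \<open>A\<close> reduces to injective \<open>C\<close> with
  \<open>C *v u = w - A *v u\<close>: there are none if the right side is zero, and otherwise
  transitivity makes their number constant.\<close>

lemma card_disjoint_through_point:
  "\<exists>K. \<forall>(A :: 'a::{field, finite} ^ 'n::finite ^ 'l::finite) u w. u \<noteq> 0 \<longrightarrow>
    card {B. inj ((*v) (B - A)) \<and> B *v u = w} = (if A *v u = w then 0 else K)"
proof (intro exI allI impI)
  fix A :: "'a ^ 'n ^ 'l" and u :: "'a ^ 'n" and w :: "'a ^ 'l"
  assume u: "u \<noteq> 0"
  have "bij_betw (\<lambda>B. B - A) {B. inj ((*v) (B - A)) \<and> B *v u = w}
      {C. inj ((*v) C) \<and> C *v u = w - A *v u}"
    by (rule bij_betw_byWitness[of _ "\<lambda>C. C + A"])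
      (auto simp: matrix_vector_mult_diff_rdistrib matrix_vector_mult_add_rdistrib)
  then have card: "card {B. inj ((*v) (B - A)) \<and> B *v u = w}
      = card {C :: 'a ^ 'n ^ 'l. inj ((*v) C) \<and> C *v u = w - A *v u}"
    by (rule bij_betw_same_card)
  \<comment> \<open>\<open>K\<close> is read off at one reference pair of nonzero vectors;
    \<open>undefined\<close> merely picks some index of each type.\<close>
  show "card {B. inj ((*v) (B - A)) \<and> B *v u = w} = (if A *v u = w then 0 else
      card {C :: 'a ^ 'n ^ 'l. inj ((*v) C) \<and> C *v axis undefined 1 = axis undefined 1})"
  proof (cases "A *v u = w")
    case True
    then have "{C :: 'a ^ 'n ^ 'l. inj ((*v) C) \<and> C *v u = w - A *v u} = {}"
      using u by (auto simp: vec.inj_iff_eq_0)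
    with True card show ?thesis by simp
  next
    case False
    then have "w - A *v u \<noteq> 0" by simp
    then have "card {C :: 'a ^ 'n ^ 'l. inj ((*v) C) \<and> C *v u = w - A *v u} =
        card {C :: 'a ^ 'n ^ 'l. inj ((*v) C) \<and> C *v axis undefined 1 = axis undefined 1}"
      using u by (intro antisym card_injective_matrices_mono) (simp_all add: axis_eq_0_iff)
    with False card show ?thesis by simp
  qed
qed

section \<open>Number of vertices through a point\<close>

lemma exists_matrix_mapping:
  fixes u :: "'a::field ^ 'n" and w :: "'a ^ 'l"
  assumes "u \<noteq> 0"
  shows "\<exists>C. C *v u = w"
proof -
  obtain i where i: "u $ i \<noteq> 0"
    using assms by (auto simp: vec_eq_iff)
  have "(\<chi> j k. if k = i then w $ j / u $ i else 0) *v u = w"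
    using i by (simp add: vec_eq_iff matrix_vector_mult_def if_distrib [of "\<lambda>t. t * _"] cong: if_cong)
  then show ?thesis ..
qed

text \<open>The value at \<open>u\<close> partitions all matrices into
  \<open>CARD('a) ^ CARD('l)\<close> classes, and translations show that these have equal
  size.\<close>

lemma card_vertices_through_point:
  fixes u :: "'a::{field, finite} ^ 'n::finite" and w :: "'a ^ 'l::finite"
  assumes "u \<noteq> 0"
  shows "card {A. A *v u = w} = CARD('a) ^ ((CARD('n) - 1) * CARD('l))"
proof -
  have const: "card {A. A *v u = w'} = card {A. A *v u = w}" for w' :: "'a ^ 'l"
  proof -
    obtain C where C: "C *v u = w - w'"
      using exists_matrix_mapping[OF assms] by blast
    have "bij_betw (\<lambda>A. A + C) {A. A *v u = w'} {A. A *v u = w}"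
      by (rule bij_betw_byWitness[of _ "\<lambda>A. A - C"])
        (auto simp: C matrix_vector_mult_diff_rdistrib matrix_vector_mult_add_rdistrib)
    then show ?thesis by (rule bij_betw_same_card)
  qed
  have "CARD('a ^ 'n ^ 'l) = card (\<Union>w' :: 'a ^ 'l. {A. A *v u = w'})"
    by (rule arg_cong[of _ _ card]) auto
  also have "\<dots> = (\<Sum>w' :: 'a ^ 'l\<in>UNIV. card {A. A *v u = w'})"
    by (rule card_UN_disjoint) (simp_all add: disjoint_iff)
  also have "\<dots> = CARD('a) ^ CARD('l) * card {A. A *v u = w}"
    by (subst sum.cong[OF refl const]) simp_all
  finally have "CARD('a) ^ CARD('l) * card {A. A *v u = w} = CARD('a) ^ (CARD('n) * CARD('l))"
    by (simp add: power_mult)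
  \<comment> \<open>The truncated subtraction is exact because index types are nonempty.\<close>
  also have "CARD('n) * CARD('l) = CARD('l) + (CARD('n) - 1) * CARD('l)"
    by (cases "CARD('n)") auto
  finally show ?thesis
    by (simp add: power_add)
qed

section \<open>Double counting with point weights\<close>

theorem theorem4p1:
  fixes L :: "('a::{field, finite} ^ ('n::finite + 'l::finite)) set set"
  assumes "CARD('n) \<le> CARD('l)"
    and "cameron_liebler L 1"
  shows "trivial_CL L 1"
proof -
  define pts :: "('a ^ ('n + 'l)) set set" where "pts = bil_points"
  define f :: "'a ^ 'n ^ 'l \<Rightarrow> real" where "f A = of_bool (matrix_graph A \<in> L)" for A
  obtain K where K: "\<forall>(A :: 'a ^ 'n ^ 'l) u w. u \<noteq> 0 \<longrightarrow>
      card {B. inj ((*v) (B - A)) \<and> B *v u = w} = (if A *v u = w then 0 else K)"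
    using card_disjoint_through_point ..
  define M where "M = CARD('a) ^ ((CARD('n) - 1) * CARD('l))"
  have L: "L \<subseteq> bil_vertices"
    using assms(2) by (simp add: cameron_liebler_def)
  have "M > 0" by (simp add: M_def)
  have cardL: "real (card L) = real M"
    using assms(2) by (simp add: cameron_liebler_def M_def field_simps)
  obtain y where y: "char_vec L = (\<lambda>\<pi>\<in>bil_vertices. \<Sum>P\<in>bil_points. incidence P \<pi> * y P)"
    using assms(2) unfolding cameron_liebler_def im_incidence_transpose_def by blast
  have f: "f A = (\<Sum>P\<in>pts. of_bool (P \<subseteq> matrix_graph A) * y P)" for A
    using fun_cong[OF y, of "matrix_graph A"]
    by (simp add: char_vec_def matrix_graph_in_vertices incidence_def pts_def f_def of_bool_def)
  \<comment> \<open>Exchanging the sums serves both counts: \<open>S\<close> will be all matrices,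
    then those whose graphs are disjoint from a fixed one.\<close>
  have count: "(\<Sum>A\<in>S. f A) = (\<Sum>P\<in>pts. real (card {A\<in>S. P \<subseteq> matrix_graph A}) * y P)" for S
    unfolding f by (subst sum.swap) (simp add: sum_distrib_right[symmetric] of_bool_def sum.If_cases Int_def)
  have "bij_betw matrix_graph {A. matrix_graph A \<in> L} L"
  proof (rule bij_betw_imageI)
    show "inj_on matrix_graph {A. matrix_graph A \<in> L}"
      by (rule inj_on_subset[OF inj_matrix_graph]) simp
    show "matrix_graph ` {A. matrix_graph A \<in> L} = L"
    proof
      show "L \<subseteq> matrix_graph ` {A. matrix_graph A \<in> L}"
      proof
        fix \<pi> assume "\<pi> \<in> L"
        moreover then obtain A where "\<pi> = matrix_graph A"
          using L vertex_is_matrix_graph by (metis subsetD)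
        ultimately show "\<pi> \<in> matrix_graph ` {A. matrix_graph A \<in> L}" by simp
      qed
    qed auto
  qed
  then have "card {A :: 'a ^ 'n ^ 'l. matrix_graph A \<in> L} = card L"
    by (rule bij_betw_same_card)
  \<comment> \<open>The value 1 of the parameter enters through \<open>cardL\<close>: the total of
    \<open>f\<close> is \<open>M\<close>, which is also the coefficient of every \<open>y P\<close>,
    so \<open>M\<close> cancels.\<close>
  then have "real M = (\<Sum>A\<in>UNIV. f A)"
    using cardL by (simp add: f_def)
  also have "\<dots> = (\<Sum>P\<in>pts. real M * y P)"
    unfolding count
  proof (rule sum.cong[OF refl])
    fix P assume "P \<in> pts"
    then obtain u :: "'a ^ 'n" and w :: "'a ^ 'l"
      where "u \<noteq> 0" "\<And>A. P \<subseteq> matrix_graph A \<longleftrightarrow> A *v u = w"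
      using point_generator unfolding pts_def by blast
    then show "real (card {A \<in> UNIV. P \<subseteq> matrix_graph A}) * y P = real M * y P"
      by (simp add: card_vertices_through_point M_def)
  qed
  finally have Y: "(\<Sum>P\<in>pts. y P) = 1"
    using \<open>M > 0\<close> by (simp add: sum_distrib_left[symmetric])
  have disjoint: "(\<Sum>B | inj ((*v) (B - A)). f B) = K * (1 - f A)" for A
  proof -
    \<comment> \<open>The bracket keeps the weight of \<open>P\<close> exactly when \<open>P\<close>
      is not on \<open>A\<close>, matching the two cases of \<open>K\<close>.\<close>
    have "(\<Sum>B | inj ((*v) (B - A)). f B)
        = (\<Sum>P\<in>pts. real K * (y P - of_bool (P \<subseteq> matrix_graph A) * y P))"
      unfolding count
    proof (rule sum.cong[OF refl])
      fix P assume "P \<in> pts"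
      then obtain u :: "'a ^ 'n" and w :: "'a ^ 'l"
        where "u \<noteq> 0" "\<And>A. P \<subseteq> matrix_graph A \<longleftrightarrow> A *v u = w"
        using point_generator unfolding pts_def by blast
      then show "real (card {B \<in> {B. inj ((*v) (B - A))}. P \<subseteq> matrix_graph B}) * y P
          = real K * (y P - of_bool (P \<subseteq> matrix_graph A) * y P)"
        by (simp add: K)
    qed
    also have "\<dots> = K * (1 - f A)"
      by (simp add: sum_distrib_left[symmetric] sum_subtractf Y f)
    finally show ?thesis .
  qed
  have "vec.dim (\<pi> \<inter> \<pi>') \<ge> 1" if \<pi>: "\<pi> \<in> L" "\<pi>' \<in> L" for \<pi> \<pi>'
  proof (rule ccontr)
    assume "\<not> vec.dim (\<pi> \<inter> \<pi>') \<ge> 1"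
    obtain A B where AB: "\<pi> = matrix_graph A" "\<pi>' = matrix_graph B"
      using \<pi> L vertex_is_matrix_graph by (metis subsetD)
    have "vec.dim (matrix_graph A \<inter> matrix_graph B) = 0"
      using \<open>\<not> vec.dim (\<pi> \<inter> \<pi>') \<ge> 1\<close> unfolding AB by linarith
    then have "inj ((*v) (B - A))"
      by (rule disjoint_matrix_graphs[THEN iffD1])
    \<comment> \<open>As \<open>f\<close> is nonnegative, the term of \<open>B\<close>, which equals
      1, is bounded by a sum that vanishes because \<open>f A = 1\<close>.\<close>
    then have "f B \<le> (\<Sum>B | inj ((*v) (B - A)). f B)"
      by (intro member_le_sum) (auto simp: f_def)
    also have "\<dots> = 0"
      unfolding disjoint using \<pi> AB by (simp add: f_def)
    finally show False
      using \<pi> AB by (simp add: f_def)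
  qed
  then have "intersecting_family L"
    using L by (simp add: intersecting_family_def)
  then show ?thesis
    unfolding trivial_CL_def using assms(2)
    \<comment> \<open>A single family suffices for parameter 1, namely \<open>L\<close>
      itself.\<close>
    by (intro conjI exI[of _ 1] exI[of _ "\<lambda>_. L"]) auto
qed

end
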